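(* Let $G$ be an arbitrary finite group and let $d$ be an arbitrary generalized Levenshtein distance. Then there are $n\in\mathbb{N}$ and a language $L \subset \{0,1\}^{24n}$ such that $|L| = n$, $Isom_d(L)\cong G$, and $d(u,v)\in\{4, 6\}$ for any two distinct words $u,v\in L$.
   Context: For a finite alphabet $A$, $A^*$ is the set of all finite words over $A$, $A^k$ is the set of all words of length $k$ over $A$, and a language is a subset of $A^*$. For real $\gamma,\theta>0$ the generalized Levenshtein distance with insertion (equivalently, removal) weight $\gamma$ and replacement weight $\theta$ is $$lev_{\gamma,\theta}(u,v)=\min\{\gamma n+\theta m \mid u \text{ can be transformed into } v \text{ by } n \text{ insertions or deletions of single characters and } m \text{ replacements of single characters}\}.$$ It is a metric on $A^*$. A generalized Levenshtein distance is any metric of this form. $Isom_d(L)$ is the group (under composition) of all bijections $\phi:L\to L$ with $d(\phi(u),\phi(v))=d(u,v)$ for all $u,v\in L$.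
   Formalization: The values 4 and 6 are impossible for arbitrary weights (for γ = θ = 100 distinct words are at distance at least 100); the distances proved are 4c and 6c with c = min(θ, 2γ), the distance between two different one-letter words. For c = 1 this is the stated claim. *)

theory Defs
  imports Complex_Main "HOL-Algebra.Bij"
begin

text \<open>
  \<open>edits n m u v\<close>: the word \<open>u\<close> can be transformed into \<open>v\<close> by \<open>n\<close> insertions or deletions and \<open>m\<close>
  replacements of single characters, performed in any order. The alphabet is the type \<open>'a\<close>.
\<close>
inductive edits :: "nat \<Rightarrow> nat \<Rightarrow> 'a list \<Rightarrow> 'a list \<Rightarrow> bool" where
  edits_refl: "edits 0 0 u u"
| edits_insert: "edits n m u (xs @ ys) \<Longrightarrow> edits (Suc n) m u (xs @ a # ys)"
| edits_delete: "edits n m u (xs @ a # ys) \<Longrightarrow> edits (Suc n) m u (xs @ ys)"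
| edits_replace: "edits n m u (xs @ a # ys) \<Longrightarrow> edits n (Suc m) u (xs @ b # ys)"

text \<open>
  For positive weights the infimum is a minimum, see \<open>lev_minimum\<close> below.
\<close>
definition lev :: "real \<Rightarrow> real \<Rightarrow> 'a list \<Rightarrow> 'a list \<Rightarrow> real" where
  "lev \<gamma> \<theta> u v = Inf {\<gamma> * real n + \<theta> * real m | n m. edits n m u v}"

lemma edits_delete_all: "\<exists>n. edits n 0 u ([] :: 'a list)"
proof -
  have "edits k 0 u (drop k u)" if "k \<le> length u" for k
    using that
  proof (induction k)
    case 0
    show ?case by (simp add: edits_refl)
  next
    case (Suc k)
    then have "edits k 0 u ([] @ u ! k # drop (Suc k) u)"
      by (simp add: Cons_nth_drop_Suc)
    from edits_delete[OF this] show ?case by simp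
  qed
  from this[of "length u"] show ?thesis by auto
qed

lemma edits_exist: "\<exists>n. edits n 0 u (v :: 'a list)"
proof (induction v)
  case Nil
  show ?case by (rule edits_delete_all)
next
  case (Cons a v)
  then obtain n where "edits n 0 u ([] @ v)" by auto
  from edits_insert[OF this, of a] show ?case by auto
qed

lemma lev_minimum:
  fixes u v :: "'a list"
  assumes "\<gamma> > 0" "\<theta> > 0"
  shows "\<exists>n m. edits n m u v \<and> lev \<gamma> \<theta> u v = \<gamma> * real n + \<theta> * real m"
    and "edits n' m' u v \<Longrightarrow> lev \<gamma> \<theta> u v \<le> \<gamma> * real n' + \<theta> * real m'"
proof -
  define C where "C = {\<gamma> * real n + \<theta> * real m | n m. edits n m u v}"
  have nonneg: "0 \<le> x" if "x \<in> C" for x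
    using that assms by (auto simp: C_def)
  obtain n0 where n0: "edits n0 0 u v" using edits_exist by blast
  define B where "B = \<gamma> * real n0"
  have "B \<in> C" using n0 unfolding C_def B_def by force
  have "finite (C \<inter> {..B})"
  proof (rule finite_subset)
    show "C \<inter> {..B} \<subseteq> (\<lambda>(n, m). \<gamma> * real n + \<theta> * real m) `
      ({..nat \<lceil>B / \<gamma>\<rceil>} \<times> {..nat \<lceil>B / \<theta>\<rceil>})"
    proof
      fix x assume "x \<in> C \<inter> {..B}"
      then obtain n m where x: "x = \<gamma> * real n + \<theta> * real m" and le: "x \<le> B"
        by (auto simp: C_def)
      have "0 \<le> \<gamma> * real n" "0 \<le> \<theta> * real m" using assms by simp_all
      then have "\<gamma> * real n \<le> B" "\<theta> * real m \<le> B" using x le by linarith+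
      then have "real n \<le> B / \<gamma>" "real m \<le> B / \<theta>"
        using assms by (simp_all add: field_simps)
      then have "n \<le> nat \<lceil>B / \<gamma>\<rceil>" "m \<le> nat \<lceil>B / \<theta>\<rceil>" by linarith+
      then show "x \<in> (\<lambda>(n, m). \<gamma> * real n + \<theta> * real m) `
        ({..nat \<lceil>B / \<gamma>\<rceil>} \<times> {..nat \<lceil>B / \<theta>\<rceil>})"
        using x by force
    qed
  qed simp
  then have fin: "finite (C \<inter> {..B})" and ne: "C \<inter> {..B} \<noteq> {}" using \<open>B \<in> C\<close> by auto
  define \<mu> where "\<mu> = Min (C \<inter> {..B})"
  have mu: "\<mu> \<in> C" "\<mu> \<le> B" using Min_in[OF fin ne] by (auto simp: \<mu>_def)
  have least: "\<mu> \<le> x" if "x \<in> C" for x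
  proof (cases "x \<le> B")
    case True
    then show ?thesis using that Min_le[OF fin, of x] by (simp add: \<mu>_def)
  next
    case False
    then show ?thesis using mu by simp
  qed
  have eq: "lev \<gamma> \<theta> u v = \<mu>"
    unfolding lev_def C_def[symmetric] using mu least by (intro cInf_eq_minimum)
  show "\<exists>n m. edits n m u v \<and> lev \<gamma> \<theta> u v = \<gamma> * real n + \<theta> * real m"
    using mu(1) unfolding eq C_def by blast
  show "edits n' m' u v \<Longrightarrow> lev \<gamma> \<theta> u v \<le> \<gamma> * real n' + \<theta> * real m'"
    unfolding eq by (rule least) (auto simp: C_def)
qed

text \<open>
  \<open>BijGroup L\<close> consists of the extensional bijections of \<open>L\<close>, so that each self-map of \<open>L\<close> is
  represented by exactly one function.
\<close>
definition Isom :: "('b \<Rightarrow> 'b \<Rightarrow> real) \<Rightarrow> 'b set \<Rightarrow> ('b \<Rightarrow> 'b) monoid" where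
  "Isom d L = (BijGroup L)
     \<lparr>carrier := {\<phi> \<in> Bij L. \<forall>u\<in>L. \<forall>v\<in>L. d (\<phi> u) (\<phi> v) = d u v}\<rparr>"

text \<open>
  The distance of two distinct one-letter words, see \<open>lev_single_letters\<close> below. It serves as the
  unit of length: scaling both weights scales all distances by the same factor, so absolute
  values such as 4 and 6 are meaningful for arbitrary weights only relative to such a unit.
\<close>
definition letter_dist :: "real \<Rightarrow> real \<Rightarrow> real" where
  "letter_dist \<gamma> \<theta> = min \<theta> (2 * \<gamma>)"

lemma edits_parity: "edits n m u v \<Longrightarrow> even (n + length u + length v)"
  by (induction rule: edits.induct) auto

lemma edits_0_0: "edits 0 0 u v \<Longrightarrow> u = v"
  by (auto elim: edits.cases)

lemma lev_single_letters:
  assumes "\<gamma> > 0" "\<theta> > 0" "a \<noteq> b"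
  shows "lev \<gamma> \<theta> [a] [b] = letter_dist \<gamma> \<theta>"
proof (rule antisym)
  have "edits 0 1 [a] [b]"
    using edits_replace[of 0 0 "[a]" "[]" a "[]" b] by (simp add: edits_refl)
  from lev_minimum(2)[OF assms(1,2) this] have 1: "lev \<gamma> \<theta> [a] [b] \<le> \<theta>" by simp
  have "edits 1 0 [a] []"
    using edits_delete[of 0 0 "[a]" "[]" a "[]"] by (simp add: edits_refl)
  then have "edits 2 0 [a] [b]"
    using edits_insert[of 1 0 "[a]" "[]" "[]" b] by (simp add: numeral_2_eq_2)
  from lev_minimum(2)[OF assms(1,2) this] have 2: "lev \<gamma> \<theta> [a] [b] \<le> 2 * \<gamma>" by simp
  from 1 2 show "lev \<gamma> \<theta> [a] [b] \<le> letter_dist \<gamma> \<theta>" by (simp add: letter_dist_def)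
next
  obtain n m where e: "edits n m [a] [b]"
    and l: "lev \<gamma> \<theta> [a] [b] = \<gamma> * real n + \<theta> * real m"
    using lev_minimum(1)[OF assms(1,2)] by blast
  show "letter_dist \<gamma> \<theta> \<le> lev \<gamma> \<theta> [a] [b]"
  proof (cases "m = 0")
    case True
    then have "n \<noteq> 0" using e assms(3) edits_0_0[of "[a]" "[b]"] by (cases n) auto
    moreover have "even n" using edits_parity[OF e] by simp
    ultimately have "real n \<ge> 2" by (cases n) (auto elim: oddE)
    then have "\<gamma> * 2 \<le> \<gamma> * real n" using assms(1) by (intro mult_left_mono) auto
    then show ?thesis using True l by (simp add: letter_dist_def)
  next
    case False
    then have "\<theta> * 1 \<le> \<theta> * real m" using assms(2) by (intro mult_left_mono) auto
    moreover have "0 \<le> \<gamma> * real n" using assms(1) by simp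
    ultimately show ?thesis using l by (simp add: letter_dist_def)
  qed
qed

end

theory Submission
  imports Defs
begin

text \<open>
  Words are constructed from triples of points, such that distinct triples share at most one point:
  each point is encoded by a block of 8 letters in which membership flips a single letter. The
  Hamming distance of two such words is 4 if the triples meet and 6 otherwise, so that the isometry
  group is the automorphism group of the intersection graph of the triples. The triples are the
  (row, column, symbol) cells of the Cayley table of \<open>G\<close>, together with triples that
  single out the rows and each of the symbols. A permutation of the cells that preserves
  rows and columns and fixes every symbol is a left translation by a group element.
\<close>

section \<open>Concatenating and splitting edit scripts\<close>

lemma edits_append_right: "edits n m u v \<Longrightarrow> edits n m (u @ w) (v @ w)"
proof (induction rule: edits.induct)
  case (edits_refl u)
  show ?case by (rule edits.edits_refl)
next
  case (edits_insert n m u xs ys a)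
  then show ?case using edits.edits_insert[of n m "u @ w" xs "ys @ w" a] by simp
next
  case (edits_delete n m u xs a ys)
  then show ?case using edits.edits_delete[of n m "u @ w" xs a "ys @ w"] by simp
next
  case (edits_replace n m u xs a ys b)
  then show ?case using edits.edits_replace[of n m "u @ w" xs a "ys @ w" b] by simp
qed

lemma edits_append:
  assumes "edits n m u v" "edits n' m' u' v'"
  shows "edits (n + n') (m + m') (u @ u') (v @ v')"
  using assms(2)
proof (induction rule: edits.induct)
  case (edits_refl u')
  show ?case using edits_append_right[OF assms(1)] by simp
next
  case (edits_insert n' m' u' xs ys a)
  then show ?case using edits.edits_insert[of "n + n'" "m + m'" "u @ u'" "v @ xs" ys a] by simp
next
  case (edits_delete n' m' u' xs a ys)
  then show ?case using edits.edits_delete[of "n + n'" "m + m'" "u @ u'" "v @ xs" a ys] by simp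
next
  case (edits_replace n' m' u' xs a ys b)
  then show ?case using edits.edits_replace[of "n + n'" "m + m'" "u @ u'" "v @ xs" a ys b] by simp
qed

text \<open>Each operation acts at one position of the current word and can be charged to the side
  of the cut that contains it; an insertion exactly at the cut may go to either side. In this way a
  script for a code word is cut into scripts for its blocks.\<close>

lemma edits_split:
  assumes "edits n m (u1 @ u2) v"
  shows "\<exists>v1 v2 n1 n2 m1 m2. v = v1 @ v2 \<and> n = n1 + n2 \<and> m = m1 + m2 \<and>
    edits n1 m1 u1 v1 \<and> edits n2 m2 u2 v2"
  using assms
proof (induction n m "u1 @ u2" v rule: edits.induct)
  case edits_refl
  show ?case
    by (intro exI[of _ u1] exI[of _ u2] exI[of _ 0]) (auto intro: edits.edits_refl)
next
  case (edits_insert n m xs ys a)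
  then obtain v1 v2 n1 n2 m1 m2 where *: "xs @ ys = v1 @ v2" "n = n1 + n2" "m = m1 + m2"
    "edits n1 m1 u1 v1" "edits n2 m2 u2 v2" by blast
  then consider zs where "xs = v1 @ zs" "v2 = zs @ ys" | zs where "v1 = xs @ zs" "ys = zs @ v2"
    by (auto simp: append_eq_append_conv2)
  then show ?case
  proof cases
    case 1
    then show ?thesis using * edits.edits_insert[of n2 m2 u2 zs ys a]
      by (intro exI[of _ v1] exI[of _ "zs @ a # ys"] exI[of _ n1] exI[of _ "Suc n2"]
          exI[of _ m1] exI[of _ m2]) auto
  next
    case 2
    then show ?thesis using * edits.edits_insert[of n1 m1 u1 xs zs a]
      by (intro exI[of _ "xs @ a # zs"] exI[of _ v2] exI[of _ "Suc n1"] exI[of _ n2]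
          exI[of _ m1] exI[of _ m2]) auto
  qed
next
  case (edits_delete n m xs a ys)
  then obtain v1 v2 n1 n2 m1 m2 where *: "xs @ a # ys = v1 @ v2" "n = n1 + n2" "m = m1 + m2"
    "edits n1 m1 u1 v1" "edits n2 m2 u2 v2" by blast
  then consider zs where "xs = v1 @ zs" "v2 = zs @ a # ys" | zs where "v1 = xs @ a # zs" "ys = zs @ v2"
    by (auto simp: append_eq_append_conv2 append_eq_Cons_conv Cons_eq_append_conv)
  then show ?case
  proof cases
    case 1
    then show ?thesis using * edits.edits_delete[of n2 m2 u2 zs a ys]
      by (intro exI[of _ v1] exI[of _ "zs @ ys"] exI[of _ n1] exI[of _ "Suc n2"]
          exI[of _ m1] exI[of _ m2]) auto
  next
    case 2
    then show ?thesis using * edits.edits_delete[of n1 m1 u1 xs a zs]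
      by (intro exI[of _ "xs @ zs"] exI[of _ v2] exI[of _ "Suc n1"] exI[of _ n2]
          exI[of _ m1] exI[of _ m2]) auto
  qed
next
  case (edits_replace n m xs a ys b)
  then obtain v1 v2 n1 n2 m1 m2 where *: "xs @ a # ys = v1 @ v2" "n = n1 + n2" "m = m1 + m2"
    "edits n1 m1 u1 v1" "edits n2 m2 u2 v2" by blast
  then consider zs where "xs = v1 @ zs" "v2 = zs @ a # ys" | zs where "v1 = xs @ a # zs" "ys = zs @ v2"
    by (auto simp: append_eq_append_conv2 append_eq_Cons_conv Cons_eq_append_conv)
  then show ?case
  proof cases
    case 1
    then show ?thesis using * edits.edits_replace[of n2 m2 u2 zs a ys b]
      by (intro exI[of _ v1] exI[of _ "zs @ b # ys"] exI[of _ n1] exI[of _ n2]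
          exI[of _ m1] exI[of _ "Suc m2"]) auto
  next
    case 2
    then show ?thesis using * edits.edits_replace[of n1 m1 u1 xs a zs b]
      by (intro exI[of _ "xs @ b # zs"] exI[of _ v2] exI[of _ n1] exI[of _ n2]
          exI[of _ "Suc m1"] exI[of _ m2]) auto
  qed
qed

lemma edits_length:
  "edits n m u v \<Longrightarrow> length u \<le> length v + n \<and> length v \<le> length u + n"
  by (induction rule: edits.induct) auto

text \<open>Rephrases a single insertion or deletion as a bounded search over positions, the form
  that \<open>block_check\<close> refutes.\<close>

lemma edits_1_0:
  assumes "edits (Suc 0) 0 u v"
  shows "(length v = Suc (length u) \<and> (\<exists>i<length v. u = take i v @ drop (Suc i) v)) \<or>
    (length u = Suc (length v) \<and> (\<exists>i<length u. v = take i u @ drop (Suc i) u))"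
  using assms
proof cases
  case (edits_insert xs ys a)
  then show ?thesis using edits_0_0[of u "xs @ ys"]
    by (intro disjI1 conjI exI[of _ "length xs"]) auto
next
  case (edits_delete xs a ys)
  then show ?thesis using edits_0_0[of u "xs @ a # ys"]
    by (intro disjI2 conjI exI[of _ "length xs"]) auto
qed

section \<open>The block code and its Levenshtein distances\<close>

definition ham :: "'a list \<Rightarrow> 'a list \<Rightarrow> nat" where
  "ham xs ys = length (filter (\<lambda>(x, y). x \<noteq> y) (zip xs ys))"

lemma ham_simps [simp]:
  "ham [] ys = 0"
  "ham (x # xs) (y # ys) = (if x = y then ham xs ys else Suc (ham xs ys))"
  by (simp_all add: ham_def)

text \<open>
  Edit scripts can be cheaper than the Hamming distance only by shifting parts of a word. In
  this code, found by computer search, fewer than two insertions or deletions never turn a block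
  into a factor of a code word that starts within 5 letters of an opposite block, see
  \<open>block_check\<close>; scripts with larger shifts cost too much anyway.
\<close>
definition block :: "bool \<Rightarrow> bool list" where
  "block x = [False, True, x, False, False, False, False, True]"

text \<open>The last five letters, common to both blocks. In front of a code word they stand for a
  preceding block, so that factors starting up to five letters too early are covered.\<close>

definition block_end :: "bool list" where
  "block_end = [False, False, False, False, True]"

definition enc :: "bool list \<Rightarrow> bool list" where
  "enc xs = concat (map block xs)"

lemma enc_simps [simp]: "enc [] = []" "enc (x # xs) = block x @ enc xs"
  by (simp_all add: enc_def)

lemma length_block [simp]: "length (block x) = 8" "length block_end = 5"
  by (simp_all add: block_def block_end_def)

lemma length_enc [simp]: "length (enc xs) = 8 * length xs"
  by (induction xs) auto

text \<open>The offset \<open>s\<close> stands for a shift of \<open>s - 5\<close> against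
  \<open>block x\<close>. The three clauses exclude the empty script, a single insertion and a
  single deletion, whose results have length 8, 9 and 7. Quantification over explicit lists makes
  all cases computable by the simplifier.\<close>

lemma block_check:
  "list_all (\<lambda>x. list_all (\<lambda>y. list_all (\<lambda>s.
     let z = drop s (block_end @ block x @ take 5 (block y)) in
       (take 8 z \<noteq> block (\<not> x)) \<and>
       list_all (\<lambda>i. take i (take 9 z) @ drop (Suc i) (take 9 z) \<noteq> block (\<not> x)) [0..<9] \<and>
       list_all (\<lambda>i. take i (block (\<not> x)) @ drop (Suc i) (block (\<not> x)) \<noteq> take 7 z) [0..<8])
   [0..<11]) [False, True]) [False, True]"
  by (simp add: block_def block_end_def upt_conv_Cons)

text \<open>Weight below 2 leaves room for at most one insertion or deletion and for no replacement,
  so \<open>v\<close> has length 8, 9 or 7; each is excluded by \<open>block_check\<close>.\<close>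

lemma edits_block:
  assumes "edits n m (block (\<not> x)) v"
    and "v = take l (drop s (block_end @ block x @ take 5 (block y)))"
    and "length v = l" and "s \<le> 10"
  shows "2 \<le> n + 2 * m"
proof (rule ccontr)
  assume "\<not> ?thesis"
  then have nm: "m = 0" "n = 0 \<or> n = Suc 0" by auto
  define z where "z = drop s (block_end @ block x @ take 5 (block y))"
  have v: "v = take l z" using assms(2) by (simp add: z_def)
  have s: "s \<in> set [0..<11]" using assms(4) by auto
  have xy: "x \<in> set [False, True]" "y \<in> set [False, True]" by auto
  note check = block_check[unfolded list_all_iff Let_def, THEN bspec, OF xy(1), THEN bspec, OF xy(2),
      THEN bspec, OF s, folded z_def]
  have chk: "take 8 z \<noteq> block (\<not> x)"
    "\<forall>i<9. take i (take 9 z) @ drop (Suc i) (take 9 z) \<noteq> block (\<not> x)"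
    "\<forall>i<8. take i (block (\<not> x)) @ drop (Suc i) (block (\<not> x)) \<noteq> take 7 z"
    using check by (simp_all only: set_upt atLeastLessThan_iff Ball_def) simp_all
  show False
  proof (cases "n = 0")
    case True
    then have "v = block (\<not> x)" using edits_0_0 assms(1) nm(1) by blast
    then show False using chk(1) v assms(3) by simp
  next
    case False
    then have "edits (Suc 0) 0 (block (\<not> x)) v" using assms(1) nm by simp
    from edits_1_0[OF this] show False
    proof (elim disjE conjE exE)
      fix i assume i: "length v = Suc (length (block (\<not> x)))" "i < length v"
        "block (\<not> x) = take i v @ drop (Suc i) v"
      have "l = 9" "i < 9" using i(1,2) assms(3) by simp_all
      then show False using chk(2) v i(3) by metis
    next
      fix i assume i: "length (block (\<not> x)) = Suc (length v)" "i < length (block (\<not> x))"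
        "v = take i (block (\<not> x)) @ drop (Suc i) (block (\<not> x))"
      have "l = 7" "i < 8" using i(1,2) assms(3) by simp_all
      then show False using chk(3) v i(3) by metis
    qed
  qed
qed

text \<open>Induction along the blocks, where \<open>s - 5\<close> is the shift accumulated so far.
  The remaining weight plus the size of the shift stays at most 10, since an insertion or deletion
  has weight 1 and changes the shift by at most 1. Differing blocks cost at least 2 by
  \<open>edits_block\<close>.\<close>

lemma enc_edits_ge_aux:
  assumes "edits n m (enc as) (drop s (block_end @ enc bs))"
    and "length as = length bs" and "s \<le> 10"
    and "int n + 2 * int m + \<bar>int s - 5\<bar> \<le> 10"
  shows "2 * ham as bs \<le> n + 2 * m"
  using assms
proof (induction as arbitrary: bs n m s)
  case Nil
  then show ?case by simp
next
  case (Cons a as)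
  then obtain b bs' where bs: "bs = b # bs'" "length as = length bs'" by (cases bs) auto
  define z where "z = drop s (block_end @ block b @ enc bs')"
  have "edits n m (block a @ enc as) z" using Cons.prems(1) by (simp add: bs z_def)
  from edits_split[OF this] obtain v1 v2 n1 n2 m1 m2 where
    *: "z = v1 @ v2" "n = n1 + n2" "m = m1 + m2"
    "edits n1 m1 (block a) v1" "edits n2 m2 (enc as) v2" by blast
  define l where "l = length v1"
  have v1: "v1 = take l z" and v2: "v2 = drop l z" using *(1) by (simp_all add: l_def)
  have lz: "length z = 13 + 8 * length bs' - s" by (simp add: z_def)
  have lv: "l + length v2 = length z" using *(1) by (simp add: l_def)
  have len1: "8 \<le> l + n1" "l \<le> 8 + n1" using edits_length[OF *(4)] by (simp_all add: l_def)
  have len2: "8 * length bs' \<le> length v2 + n2" "length v2 \<le> 8 * length bs' + n2"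
    using edits_length[OF *(5)] bs by simp_all
  \<comment> \<open>The new offset \<open>s + l - 8\<close> differs from 5 by at most
    \<open>n1\<close> plus the old shift, by the lengths of \<open>block a\<close> and
    \<open>v1\<close>, and by at most \<open>n2\<close>, by the lengths of the remainders. The two
    bounds sum to at most 10, so the new shift is at most 5.\<close>
  have ge: "8 \<le> s + l" and le: "s + l - 8 \<le> 10"
    and inv: "int n2 + 2 * int m2 + \<bar>int (s + l - 8) - 5\<bar> \<le> 10"
    using len1 len2 lz lv Cons.prems(3,4) *(2,3) by linarith+
  \<comment> \<open>Eight letters further the target again is \<open>block_end\<close> followed by a
    code word, so the induction hypothesis applies at the new offset.\<close>
  have "drop 8 (block_end @ block b) = block_end" by (simp add: block_def block_end_def)
  then have "drop 8 (block_end @ block b @ enc bs') = block_end @ enc bs'"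
    by (metis append.assoc drop_append length_append length_block add_diff_cancel_right'
        drop_0 diff_is_0_eq' le_add2)
  moreover have "v2 = drop (s + l - 8) (drop 8 (block_end @ block b @ enc bs'))"
    unfolding v2 z_def drop_drop using ge by (simp add: add.commute)
  ultimately have "v2 = drop (s + l - 8) (block_end @ enc bs')" by simp
  then have IH: "2 * ham as bs' \<le> n2 + 2 * m2"
    using Cons.IH[of n2 m2 "s + l - 8" bs'] *(5) bs(2) le inv by simp
  show ?case
  proof (cases "a = b")
    case True
    then show ?thesis using IH *(2,3) bs by simp
  next
    case False
    then have a: "a = (\<not> b)" by auto
    \<comment> \<open>The factor \<open>v1\<close> reaches at most five letters into the next block.
      If there is no next block, the default \<open>False\<close> is never read.\<close>
    define y where "y = (case bs' of [] \<Rightarrow> False | c # _ \<Rightarrow> c)"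
    have "take l (drop s (block_end @ block b @ enc bs')) =
      take l (drop s (block_end @ block b @ take 5 (block y)))"
    proof (cases bs')
      case Nil
      then show ?thesis using lz lv by simp
    next
      case (Cons c cs)
      have "l + s \<le> 18" using le by simp
      then show ?thesis by (simp add: y_def Cons take_drop)
    qed
    then have "v1 = take l (drop s (block_end @ block b @ take 5 (block y)))"
      using v1 unfolding z_def by (rule trans[rotated])
    then have "2 \<le> n1 + 2 * m1"
      by (rule edits_block[OF *(4)[unfolded a] _ l_def[symmetric] Cons.prems(3)])
    then show ?thesis using IH *(2,3) bs False by simp
  qed
qed

lemma enc_edits_ge:
  assumes e: "edits n m (enc as) (enc bs)" and l: "length as = length bs" and "ham as bs \<le> 6"
  shows "2 * ham as bs \<le> n + 2 * m"
proof (cases "n + 2 * m \<le> 10")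
  case True
  moreover have "edits n m (enc as) (drop 5 (block_end @ enc bs))" using e by simp
  ultimately show ?thesis using enc_edits_ge_aux[of n m as 5 bs] l by simp
next
  case False
  have "even n" using edits_parity[OF e] l by simp
  then show ?thesis using False assms(3) by presburger
qed

text \<open>Flipping the third letter of a block takes one replacement, or one deletion and one
  insertion; the two pure scripts account for the two terms of the minimum in
  \<open>letter_dist\<close>.\<close>

lemma enc_edits:
  "length as = length bs \<Longrightarrow> edits 0 (ham as bs) (enc as) (enc bs)"
  "length as = length bs \<Longrightarrow> edits (2 * ham as bs) 0 (enc as) (enc bs)"
proof -
  have 0: "edits 0 0 u u" for u :: "bool list" by (rule edits_refl)
  have r: "edits 0 1 (block a) (block b)" for a b
    using edits_replace[OF 0[of "[False, True] @ a # [False, False, False, False, True]"], of b]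
    by (simp add: block_def)
  have "edits 1 0 (block a) [False, True, False, False, False, False, True]" for a
    using edits_delete[OF 0[of "[False, True] @ a # [False, False, False, False, True]"]]
    by (simp add: block_def)
  then have i: "edits 2 0 (block a) (block b)" for a b
    using edits_insert[of 1 0 "block a" "[False, True]" "[False, False, False, False, True]" b]
    by (simp add: block_def numeral_2_eq_2)
  show "edits 0 (ham as bs) (enc as) (enc bs)" if "length as = length bs"
    using that
  proof (induction rule: list_induct2)
    case (Cons a as b bs)
    then show ?case using edits_append[OF r Cons.IH, of a b] edits_append[OF 0 Cons.IH, of "block a"]
      by auto
  qed (simp add: 0)
  show "edits (2 * ham as bs) 0 (enc as) (enc bs)" if "length as = length bs"
    using that
  proof (induction rule: list_induct2)
    case (Cons a as b bs)
    then show ?case using edits_append[OF i Cons.IH, of a b] edits_append[OF 0 Cons.IH, of "block a"]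
      by auto
  qed (simp add: 0)
qed

text \<open>The weight n + 2 m is fitted to \<open>letter_dist\<close>: an insertion or deletion
  costs at least half of this unit and a replacement at least all of it, so a script costs at least
  (n + 2 m) / 2 units.\<close>

lemma lev_enc:
  assumes "\<gamma> > 0" "\<theta> > 0" and l: "length as = length bs" and h: "ham as bs \<le> 6"
  shows "lev \<gamma> \<theta> (enc as) (enc bs) = real (ham as bs) * letter_dist \<gamma> \<theta>"
proof (rule antisym)
  note le = lev_minimum(2)[OF assms(1,2)]
  show "lev \<gamma> \<theta> (enc as) (enc bs) \<le> real (ham as bs) * letter_dist \<gamma> \<theta>"
    using le[OF enc_edits(1)[OF l]] le[OF enc_edits(2)[OF l]]
    by (simp add: letter_dist_def min_def mult_ac)
next
  obtain n m where e: "edits n m (enc as) (enc bs)"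
    and eq: "lev \<gamma> \<theta> (enc as) (enc bs) = \<gamma> * real n + \<theta> * real m"
    using lev_minimum(1)[OF assms(1,2)] by blast
  let ?c = "letter_dist \<gamma> \<theta>"
  have c: "?c > 0" "?c \<le> \<theta>" "?c \<le> 2 * \<gamma>" using assms by (simp_all add: letter_dist_def)
  have "real (2 * ham as bs) \<le> real (n + 2 * m)"
    using enc_edits_ge[OF e l h] of_nat_le_iff by blast
  then have "?c * real (2 * ham as bs) \<le> ?c * real (n + 2 * m)"
    using c(1) by (intro mult_left_mono) auto
  moreover have "?c * real n \<le> 2 * \<gamma> * real n" "?c * real m \<le> \<theta> * real m"
    using c by (intro mult_right_mono; simp)+
  ultimately show "real (ham as bs) * ?c \<le> lev \<gamma> \<theta> (enc as) (enc bs)"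
    unfolding eq by (simp add: algebra_simps)
qed

lemma lev_refl:
  assumes "\<gamma> > 0" "\<theta> > 0"
  shows "lev \<gamma> \<theta> w w = 0"
proof (rule antisym)
  show "lev \<gamma> \<theta> w w \<le> 0" using lev_minimum(2)[OF assms edits_refl] by simp
  obtain n m where "lev \<gamma> \<theta> w w = \<gamma> * real n + \<theta> * real m"
    using lev_minimum(1)[OF assms] by blast
  then show "0 \<le> lev \<gamma> \<theta> w w" using assms by simp
qed

section \<open>Code words of systems of triples\<close>

text \<open>At most \<open>3 * card V\<close> points occur, and 8 letters per point give the length
  \<open>24 * card V\<close>. Two characteristic vectors differ on the symmetric difference of the
  triples, which has 6 or 4 points as the intersection has 0 or 1.\<close>

lemma code_of_triples:
  fixes S :: "'v \<Rightarrow> 'p set"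
  assumes fin: "finite V" and card3: "\<And>v. v \<in> V \<Longrightarrow> card (S v) = 3"
    and card1: "\<And>u v. u \<in> V \<Longrightarrow> v \<in> V \<Longrightarrow> u \<noteq> v \<Longrightarrow> card (S u \<inter> S v) \<le> 1"
    and "\<gamma> > 0" "\<theta> > 0"
  shows "\<exists>f :: 'v \<Rightarrow> bool list. inj_on f V \<and> (\<forall>v\<in>V. length (f v) = 24 * card V) \<and>
    (\<forall>u\<in>V. \<forall>v\<in>V. u \<noteq> v \<longrightarrow>
      lev \<gamma> \<theta> (f u) (f v) = (if S u \<inter> S v = {} then 6 else 4) * letter_dist \<gamma> \<theta>)"
proof -
  let ?P = "\<Union>v\<in>V. S v"
  have finS: "finite (S v)" if "v \<in> V" for v using card3[OF that] card.infinite by fastforce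
  then have finP: "finite ?P" using fin by auto
  have "card ?P \<le> (\<Sum>v\<in>V. card (S v))" by (rule card_UN_le[OF fin])
  also have "\<dots> = 3 * card V" using card3 by simp
  finally have "card ?P \<le> card {..<3 * card V}" by simp
  then obtain p where p: "p ` ?P \<subseteq> {..<3 * card V}" "inj_on p ?P"
    using card_le_inj[OF finP] by blast
  define bits where "bits v = map (\<lambda>i. i \<in> p ` S v) [0..<3 * card V]" for v
  have ham: "ham (bits u) (bits v) = (if S u \<inter> S v = {} then 6 else 4)"
    if uv: "u \<in> V" "v \<in> V" "u \<noteq> v" for u v
  proof -
    have "zip (bits u) (bits v) = map (\<lambda>i. (i \<in> p ` S u, i \<in> p ` S v)) [0..<3 * card V]"
      by (simp add: bits_def zip_map_map zip_same_conv_map)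
    then have "ham (bits u) (bits v) =
        length (filter (\<lambda>i. (i \<in> p ` S u) \<noteq> (i \<in> p ` S v)) [0..<3 * card V])"
      by (simp add: ham_def filter_map o_def)
    also have "\<dots> = card {i. i < 3 * card V \<and> (i \<in> p ` S u) \<noteq> (i \<in> p ` S v)}"
      by (simp add: length_filter_conv_card cong: conj_cong)
    also have "{i. i < 3 * card V \<and> (i \<in> p ` S u) \<noteq> (i \<in> p ` S v)} =
        p ` ((S u - S v) \<union> (S v - S u))"
    proof -
      have sub: "p ` S u \<subseteq> {..<3 * card V}" "p ` S v \<subseteq> {..<3 * card V}" using p(1) uv by auto
      have diff: "p ` (S u - S v) = p ` S u - p ` S v" "p ` (S v - S u) = p ` S v - p ` S u"
        using p(2) uv by (intro inj_on_image_set_diff[of p ?P]; auto)+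
      show ?thesis unfolding image_Un diff using sub by blast
    qed
    also have "card \<dots> = card ((S u - S v) \<union> (S v - S u))"
      using p(2) uv by (intro card_image) (auto intro: inj_on_subset)
    also have "\<dots> = card (S u - S v) + card (S v - S u)"
      using finS uv by (intro card_Un_disjoint) auto
    also have "\<dots> = (3 - card (S u \<inter> S v)) + (3 - card (S u \<inter> S v))"
      using card3 finS uv by (simp add: card_Diff_subset_Int Int_commute)
    also have "\<dots> = (if S u \<inter> S v = {} then 6 else 4)"
    proof (cases "S u \<inter> S v = {}")
      case False
      then have "card (S u \<inter> S v) \<noteq> 0" using finS uv by simp
      then have "card (S u \<inter> S v) = 1" using card1[OF uv] by linarith
      then show ?thesis using False by simp
    qed simp
    finally show ?thesis .
  qed
  have len: "length (bits v) = 3 * card V" for v by (simp add: bits_def)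
  have c: "letter_dist \<gamma> \<theta> > 0" using assms by (simp add: letter_dist_def)
  have lev: "lev \<gamma> \<theta> (enc (bits u)) (enc (bits v)) =
      (if S u \<inter> S v = {} then 6 else 4) * letter_dist \<gamma> \<theta>"
    if "u \<in> V" "v \<in> V" "u \<noteq> v" for u v
    using lev_enc[OF assms(4,5), of "bits u" "bits v"] ham[OF that] len by simp
  show ?thesis
  proof (intro exI[of _ "\<lambda>v. enc (bits v)"] conjI)
    show "inj_on (\<lambda>v. enc (bits v)) V"
    proof (rule inj_onI, rule ccontr)
      fix u v assume "u \<in> V" "v \<in> V" "enc (bits u) = enc (bits v)" "u \<noteq> v"
      then show False using lev[of u v] lev_refl[OF assms(4,5), of "enc (bits v)"] c by (simp split: if_splits)
    qed
  qed (use lev len in auto)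
qed

section \<open>Isometry groups from group actions\<close>

text \<open>Moves the problem from words to the index set \<open>V\<close>: a faithful action whose
  maps are exactly the permutations preserving the distances pulled back along \<open>f\<close> is
  transported to \<open>L\<close> by conjugation with \<open>f\<close>.\<close>

lemma Isom_iso_by_action:
  fixes G :: "('g, 'x) monoid_scheme"
  assumes G: "group G" and f: "bij_betw f V L"
    and closed: "\<And>g v. g \<in> carrier G \<Longrightarrow> v \<in> V \<Longrightarrow> act g v \<in> V"
    and one: "\<And>v. v \<in> V \<Longrightarrow> act \<one>\<^bsub>G\<^esub> v = v"
    and mult: "\<And>g h v. g \<in> carrier G \<Longrightarrow> h \<in> carrier G \<Longrightarrow> v \<in> V \<Longrightarrow>
      act (g \<otimes>\<^bsub>G\<^esub> h) v = act g (act h v)"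
    and faithful: "\<And>g h. g \<in> carrier G \<Longrightarrow> h \<in> carrier G \<Longrightarrow>
      (\<And>v. v \<in> V \<Longrightarrow> act g v = act h v) \<Longrightarrow> g = h"
    and dist: "\<And>g u v. g \<in> carrier G \<Longrightarrow> u \<in> V \<Longrightarrow> v \<in> V \<Longrightarrow>
      d (f (act g u)) (f (act g v)) = d (f u) (f v)"
    and full: "\<And>\<phi>. bij_betw \<phi> V V \<Longrightarrow>
      (\<And>u v. u \<in> V \<Longrightarrow> v \<in> V \<Longrightarrow> d (f (\<phi> u)) (f (\<phi> v)) = d (f u) (f v)) \<Longrightarrow>
      \<exists>g\<in>carrier G. \<forall>v\<in>V. \<phi> v = act g v"
  shows "Isom d L \<cong> G"
proof -
  interpret G: group G by (rule G)
  let ?i = "inv_into V f"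
  have i: "bij_betw ?i L V" by (rule bij_betw_inv_into[OF f])
  have iL: "?i w \<in> V" "f (?i w) = w" if "w \<in> L" for w
    using that i f by (auto simp: bij_betw_def f_inv_into_f inv_into_into)
  have fV: "f v \<in> L" "?i (f v) = v" if "v \<in> V" for v
    using that f by (auto simp: bij_betw_def)
  \<comment> \<open>Restriction to \<open>L\<close> makes the conjugate extensional, as membership
    in \<open>Bij L\<close> demands.\<close>
  define \<Phi> where "\<Phi> g = (\<lambda>w\<in>L. f (act g (?i w)))" for g
  have bij: "bij_betw (act g) V V" if g: "g \<in> carrier G" for g
  proof (rule bij_betwI[where g = "act (inv\<^bsub>G\<^esub> g)"])
    show "act (inv\<^bsub>G\<^esub> g) (act g v) = v" if "v \<in> V" for v
      using mult[of "inv\<^bsub>G\<^esub> g" g v] one that g by simp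
    show "act g (act (inv\<^bsub>G\<^esub> g) v) = v" if "v \<in> V" for v
      using mult[of g "inv\<^bsub>G\<^esub> g" v] one that g by simp
  qed (use closed g in auto)
  have \<Phi>_Bij: "\<Phi> g \<in> Bij L" if "g \<in> carrier G" for g
  proof -
    have "bij_betw (f \<circ> (act g \<circ> ?i)) L L"
      using i f bij[OF that] by (blast intro: bij_betw_trans)
    then have "bij_betw (\<Phi> g) L L"
      by (subst bij_betw_cong[of L "\<Phi> g" "f \<circ> (act g \<circ> ?i)"]) (auto simp: \<Phi>_def)
    then show ?thesis by (simp add: Bij_def \<Phi>_def)
  qed
  have carrier: "\<Phi> g \<in> carrier (Isom d L)" if "g \<in> carrier G" for g
  proof -
    have "d (\<Phi> g u) (\<Phi> g v) = d u v" if "u \<in> L" "v \<in> L" for u v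
      using dist[OF \<open>g \<in> carrier G\<close>, of "?i u" "?i v"] that iL by (simp add: \<Phi>_def)
    then show ?thesis using \<Phi>_Bij[OF that] by (simp add: Isom_def)
  qed
  have "\<Phi> \<in> hom G (Isom d L)"
  proof (rule homI)
    fix g h assume gh: "g \<in> carrier G" "h \<in> carrier G"
    have "\<Phi> (g \<otimes>\<^bsub>G\<^esub> h) = compose L (\<Phi> g) (\<Phi> h)"
      unfolding \<Phi>_def compose_def
      by (rule restrict_ext) (use iL fV closed mult gh in auto)
    then show "\<Phi> (g \<otimes>\<^bsub>G\<^esub> h) = \<Phi> g \<otimes>\<^bsub>Isom d L\<^esub> \<Phi> h"
      using \<Phi>_Bij gh by (simp add: Isom_def BijGroup_def)
  qed (rule carrier)
  moreover have "inj_on \<Phi> (carrier G)"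
  proof (rule inj_onI)
    fix g h assume gh: "g \<in> carrier G" "h \<in> carrier G" and eq: "\<Phi> g = \<Phi> h"
    show "g = h"
    proof (rule faithful[OF gh])
      fix v assume v: "v \<in> V"
      have "\<Phi> g (f v) = \<Phi> h (f v)" using eq by simp
      then have "f (act g v) = f (act h v)" using fV[OF v] by (simp add: \<Phi>_def)
      then show "act g v = act h v" using fV closed gh v by metis
    qed
  qed
  moreover have "\<psi> \<in> \<Phi> ` carrier G" if "\<psi> \<in> carrier (Isom d L)" for \<psi>
  proof -
    have \<psi>: "\<psi> \<in> extensional L" "bij_betw \<psi> L L"
      and \<psi>d: "\<And>u v. u \<in> L \<Longrightarrow> v \<in> L \<Longrightarrow> d (\<psi> u) (\<psi> v) = d u v"
      using that by (auto simp: Isom_def Bij_def)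
    have \<psi>L: "\<psi> w \<in> L" if "w \<in> L" for w using \<psi>(2) that by (auto simp: bij_betw_def)
    have b: "bij_betw (?i \<circ> (\<psi> \<circ> f)) V V" using f i \<psi>(2) by (blast intro: bij_betw_trans)
    have "\<exists>g\<in>carrier G. \<forall>v\<in>V. (?i \<circ> (\<psi> \<circ> f)) v = act g v"
    proof (rule full[OF b])
      fix u v assume "u \<in> V" "v \<in> V"
      then show "d (f ((?i \<circ> (\<psi> \<circ> f)) u)) (f ((?i \<circ> (\<psi> \<circ> f)) v)) = d (f u) (f v)"
        using iL fV \<psi>L \<psi>d by simp
    qed
    then obtain g where g: "g \<in> carrier G" and eq: "\<forall>v\<in>V. ?i (\<psi> (f v)) = act g v" by auto
    have "\<psi> w = \<Phi> g w" if "w \<in> L" for w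
      using eq iL[OF that] iL(2)[OF \<psi>L[OF that]] that by (metis \<Phi>_def restrict_apply')
    then have "\<psi> = \<Phi> g" using \<psi>(1) by (intro extensionalityI[of _ L]) (auto simp: \<Phi>_def)
    then show ?thesis using g by blast
  qed
  ultimately have "\<Phi> \<in> iso G (Isom d L)"
    using carrier by (auto simp: iso_def bij_betw_def)
  then show ?thesis using G.iso_sym unfolding is_iso_def by blast
qed

section \<open>The intersection graph of the Cayley table and its automorphisms\<close>

datatype 'g point = RowPt 'g | ColPt 'g | SymPt nat | PathPt nat | FreePt 'g bool
datatype 'g vertex = Cell 'g nat | Row 'g | Path nat

text \<open>
  The cells with the coordinates \<open>r\<close>, \<open>r \<otimes> e i\<close>, \<open>i\<close> form the Cayley table of the group. The vertices
  \<open>Row r\<close> distinguish the rows from the columns, and the path \<open>Path 0, \<dots>, Path k\<close> numbers the symbols.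
  Since no cell has symbol 0, \<open>Path 0\<close> is an end of the path with a single neighbour.
\<close>
locale cayley_table =
  group G for G (structure) +
  fixes k :: nat and e :: "nat \<Rightarrow> 'a"
  assumes e: "bij_betw e {1..k} (carrier G)" and k: "k \<ge> 2"
begin

text \<open>The points \<open>FreePt\<close> pad the row triples to three points, and
  \<open>PathPt (Suc i)\<close> links \<open>Path i\<close> to \<open>Path (Suc i)\<close>.\<close>

fun triple :: "'a vertex \<Rightarrow> 'a point set" where
  "triple (Cell r i) = {RowPt r, ColPt (r \<otimes> e i), SymPt i}"
| "triple (Row r) = {RowPt r, FreePt r False, FreePt r True}"
| "triple (Path i) = {SymPt i, PathPt i, PathPt (Suc i)}"

fun act :: "'a \<Rightarrow> 'a vertex \<Rightarrow> 'a vertex" where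
  "act g (Cell r i) = Cell (g \<otimes> r) i"
| "act g (Row r) = Row (g \<otimes> r)"
| "act g (Path i) = Path i"

definition V :: "'a vertex set" where
  "V = {Cell r i | r i. r \<in> carrier G \<and> i \<in> {1..k}} \<union> Row ` carrier G \<union> Path ` {0..k}"

text \<open>Adjacency in the intersection graph, with a loop at every vertex.\<close>

definition meet :: "'a vertex \<Rightarrow> 'a vertex \<Rightarrow> bool" where
  "meet u v \<longleftrightarrow> triple u \<inter> triple v \<noteq> {}"

lemma in_V [simp]:
  "Cell r i \<in> V \<longleftrightarrow> r \<in> carrier G \<and> 1 \<le> i \<and> i \<le> k"
  "Row r \<in> V \<longleftrightarrow> r \<in> carrier G"
  "Path i \<in> V \<longleftrightarrow> i \<le> k"
  by (auto simp: V_def)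

lemma meet_simps [simp]:
  "meet (Cell r i) (Cell s j) \<longleftrightarrow> r = s \<or> r \<otimes> e i = s \<otimes> e j \<or> i = j"
  "meet (Cell r i) (Row s) \<longleftrightarrow> r = s"
  "meet (Row s) (Cell r i) \<longleftrightarrow> r = s"
  "meet (Cell r i) (Path j) \<longleftrightarrow> i = j"
  "meet (Path j) (Cell r i) \<longleftrightarrow> i = j"
  "meet (Row r) (Row s) \<longleftrightarrow> r = s"
  "meet (Row r) (Path j) \<longleftrightarrow> False"
  "meet (Path j) (Row r) \<longleftrightarrow> False"
  "meet (Path i) (Path j) \<longleftrightarrow> i = j \<or> i = Suc j \<or> j = Suc i"
  by (auto simp: meet_def)

lemma e_closed [simp]: "1 \<le> i \<Longrightarrow> i \<le> k \<Longrightarrow> e i \<in> carrier G"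
  using bij_betwE[OF e] by simp

lemma e_inj: "1 \<le> i \<Longrightarrow> i \<le> k \<Longrightarrow> 1 \<le> j \<Longrightarrow> j \<le> k \<Longrightarrow> e i = e j \<longleftrightarrow> i = j"
  using inj_on_eq_iff[OF bij_betw_imp_inj_on[OF e]] by simp

lemma e_surj:
  assumes "g \<in> carrier G"
  obtains i where "1 \<le> i" "i \<le> k" "e i = g"
proof -
  have "g \<in> e ` {1..k}" using e assms by (simp add: bij_betw_def)
  then show thesis using that by auto
qed

lemma card_carrier: "card (carrier G) = k"
  using bij_betw_same_card[OF e] by simp

lemma finite_carrier: "finite (carrier G)"
  using card_carrier k by (metis card.infinite not_numeral_le_zero)

lemma finite_V: "finite V"
proof -
  have "{Cell r i | r i. r \<in> carrier G \<and> i \<in> {1..k}} = (\<lambda>(r, i). Cell r i) ` (carrier G \<times> {1..k})"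
    by auto
  then show ?thesis using finite_carrier by (simp add: V_def)
qed

lemma other_element: "\<exists>s\<in>carrier G. s \<noteq> r"
proof (rule ccontr)
  assume "\<not> ?thesis"
  then have "carrier G \<subseteq> {r}" by auto
  then show False using card_mono[of "{r}" "carrier G"] card_carrier k by simp
qed

lemma card_triple: "card (triple v) = 3"
  by (cases v) auto

text \<open>For cells this is the Latin square property: by cancellation and injectivity of
  \<open>e\<close>, two of row, column and symbol determine the third.\<close>

lemma card_triple_Int:
  assumes "u \<in> V" "v \<in> V" "u \<noteq> v"
  shows "card (triple u \<inter> triple v) \<le> 1"
proof -
  have "x = y" if "x \<in> triple u \<inter> triple v" "y \<in> triple u \<inter> triple v" for x y
    using that assms by (cases u; cases v) (auto simp: e_inj)
  moreover have "finite (triple u \<inter> triple v)" by (cases u) auto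
  ultimately show ?thesis by (auto simp: card_le_Suc0_iff_eq)
qed

lemma act_closed: "g \<in> carrier G \<Longrightarrow> v \<in> V \<Longrightarrow> act g v \<in> V"
  by (cases v) auto

lemma act_one: "v \<in> V \<Longrightarrow> act \<one> v = v"
  by (cases v) auto

lemma act_mult: "g \<in> carrier G \<Longrightarrow> h \<in> carrier G \<Longrightarrow> v \<in> V \<Longrightarrow> act (g \<otimes> h) v = act g (act h v)"
  by (cases v) (auto simp: m_assoc)

lemma act_faithful:
  assumes "g \<in> carrier G" "h \<in> carrier G" "\<And>v. v \<in> V \<Longrightarrow> act g v = act h v"
  shows "g = h"
  using assms(3)[of "Row \<one>"] assms(1,2) by simp

lemma act_eq_iff: "g \<in> carrier G \<Longrightarrow> u \<in> V \<Longrightarrow> v \<in> V \<Longrightarrow> act g u = act g v \<longleftrightarrow> u = v"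
  by (cases u; cases v) auto

text \<open>Left multiplication of the row by \<open>g\<close> also left-multiplies the column
  \<open>r \<otimes> e i\<close>, so by cancellation coincidences of rows and of columns are
  kept.\<close>

lemma act_meet:
  "g \<in> carrier G \<Longrightarrow> u \<in> V \<Longrightarrow> v \<in> V \<Longrightarrow> meet (act g u) (act g v) \<longleftrightarrow> meet u v"
  by (cases u; cases v) (auto simp: m_assoc)

text \<open>Vertices are recognised by adjacency: first the end of the path, then the path one
  vertex at a time. With the symbols fixed, only a permutation \<alpha> of the rows is left, and
  shared columns force it to be a left translation.\<close>

lemma automorphism_is_act:
  assumes bij: "bij_betw \<phi> V V"
    and meet: "\<And>u v. u \<in> V \<Longrightarrow> v \<in> V \<Longrightarrow> meet (\<phi> u) (\<phi> v) \<longleftrightarrow> meet u v"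
  shows "\<exists>g\<in>carrier G. \<forall>v\<in>V. \<phi> v = act g v"
proof -
  have closed: "\<phi> v \<in> V" if "v \<in> V" for v using bij_betwE[OF bij] that by blast
  have inj: "\<phi> u = \<phi> v \<longleftrightarrow> u = v" if "u \<in> V" "v \<in> V" for u v
    using inj_on_eq_iff[OF bij_betw_imp_inj_on[OF bij]] that by blast
  have surj: "\<exists>u\<in>V. v = \<phi> u" if "v \<in> V" for v
    using bij_betw_imp_surj_on[OF bij] that by blast
  have path0: "\<phi> (Path 0) = Path 0"
  proof -
    \<comment> \<open>Having a single neighbour is invariant under \<phi>. \<open>Path 0\<close> has
      only \<open>Path 1\<close>, and the cases below name two neighbours of every other kind of
      vertex.\<close>
    have one_neighbour: "v = w" if "v \<in> V" "w \<in> V" "v \<noteq> \<phi> (Path 0)" "w \<noteq> \<phi> (Path 0)"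
      "meet v (\<phi> (Path 0))" "meet w (\<phi> (Path 0))" for v w
    proof -
      obtain v' w' where vw: "v' \<in> V" "v = \<phi> v'" "w' \<in> V" "w = \<phi> w'"
        using surj \<open>v \<in> V\<close> \<open>w \<in> V\<close> by metis
      then have "v' \<noteq> Path 0" "w' \<noteq> Path 0" "meet v' (Path 0)" "meet w' (Path 0)"
        using that meet by auto
      then have "v' = w'" using vw by (cases v'; cases w') auto
      then show ?thesis using vw by simp
    qed
    show ?thesis
    proof (cases "\<phi> (Path 0)")
      case (Cell r i)
      then show ?thesis using one_neighbour[of "Row r" "Path i"] closed[of "Path 0"] by auto
    next
      case (Row r)
      then show ?thesis using one_neighbour[of "Cell r 1" "Cell r 2"] closed[of "Path 0"] k by auto
    next
      case (Path i)
      then show ?thesis using one_neighbour[of "Path (i - 1)" "Cell \<one> i"] closed[of "Path 0"]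
        by (cases i) auto
    qed
  qed
  have path: "\<phi> (Path i) = Path i" if "i \<le> k" for i
    using that
  proof (induction i rule: less_induct)
    case (less i)
    show ?case
    proof (cases i)
      case 0
      then show ?thesis using path0 by simp
    next
      case (Suc j)
      have j: "\<phi> (Path j) = Path j" using less Suc by simp
      have m: "meet (\<phi> (Path i)) (Path j)" "\<phi> (Path i) \<noteq> Path j"
        using meet[of "Path i" "Path j"] inj[of "Path i" "Path j"] j less.prems Suc by auto
      \<comment> \<open>The path vertices before \<open>i\<close> are already fixed, so by
        injectivity none of them is the image of \<open>Path i\<close>.\<close>
      have ge: "i \<le> l" if "\<phi> (Path i) = Path l" for l
        using less.IH[of l] inj[of "Path i" "Path l"] less.prems that by (cases "i \<le> l") auto
      have "\<phi> (Path i) = Path i \<or> (\<exists>r. \<phi> (Path i) = Cell r j)"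
      proof (cases "\<phi> (Path i)")
        case (Path l)
        then show ?thesis using m(1) ge[OF Path] Suc by auto
      qed (use m in auto)
      \<comment> \<open>Consecutive path vertices have no common neighbour besides themselves,
        whereas \<open>Cell r j\<close> and \<open>Path j\<close> have every other cell with symbol
        \<open>j\<close>; one exists because the group has at least two elements.\<close>
      moreover have "\<phi> (Path i) \<noteq> Cell r j" for r
      proof
        assume r: "\<phi> (Path i) = Cell r j"
        then have "Cell r j \<in> V" using closed[of "Path i"] less.prems by simp
        moreover obtain s where s: "s \<in> carrier G" "s \<noteq> r" using other_element by blast
        ultimately obtain w where w: "w \<in> V" "\<phi> w = Cell s j" using surj[of "Cell s j"] by auto
        have "meet w (Path i)" "meet w (Path j)" "w \<noteq> Path i" "w \<noteq> Path j"
          using meet[of w "Path i"] meet[of w "Path j"] w r j s less.prems Suc by auto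
        then show False using Suc by (cases w) auto
      qed
      ultimately show ?thesis by blast
    qed
  qed
  have not_path: "\<phi> v \<noteq> Path j" if "v \<in> V" "v \<notin> range Path" for v j
    using path[of j] inj[of v "Path j"] closed[of v] that by auto
  have cell: "\<exists>s. \<phi> (Cell r i) = Cell s i" if "Cell r i \<in> V" for r i
    using meet[of "Cell r i" "Path i"] path[of i] not_path[of "Cell r i"] that
    by (cases "\<phi> (Cell r i)") auto
  \<comment> \<open>A row vertex meets no path vertex, whereas every cell meets the one of its
    symbol, which is fixed.\<close>
  have row: "\<exists>s. \<phi> (Row r) = Row s" if "r \<in> carrier G" for r
  proof (cases "\<phi> (Row r)")
    case (Cell s i)
    then show ?thesis using meet[of "Row r" "Path i"] path[of i] closed[of "Row r"] that by auto
  qed (use not_path[of "Row r"] that in auto)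
  then obtain \<alpha> where \<alpha>: "\<phi> (Row r) = Row (\<alpha> r)" if "r \<in> carrier G" for r by metis
  have \<alpha>_closed: "\<alpha> r \<in> carrier G" if "r \<in> carrier G" for r
    using closed[of "Row r"] \<alpha> that by simp
  have \<alpha>_inj: "\<alpha> r = \<alpha> s \<longleftrightarrow> r = s" if "r \<in> carrier G" "s \<in> carrier G" for r s
    using inj[of "Row r" "Row s"] \<alpha> that by simp
  have cell: "\<phi> (Cell r i) = Cell (\<alpha> r) i" if "Cell r i \<in> V" for r i
    using cell[OF that] meet[of "Cell r i" "Row r"] \<alpha>[of r] that by auto
  have \<alpha>_eq: "\<alpha> r = \<alpha> \<one> \<otimes> r" if r: "r \<in> carrier G" for r
  proof (cases "r = \<one>")
    case False
    \<comment> \<open>These symbols put a cell of row \<open>r\<close> and a cell of row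
      \<open>\<one>\<close> into the common column \<open>r\<close>. Their images differ in row and
      symbol, so they meet in a column, which is the claimed equation.\<close>
    obtain i j where ij: "1 \<le> i" "i \<le> k" "e i = \<one>" "1 \<le> j" "j \<le> k" "e j = r"
      using e_surj one_closed r by metis
    have "meet (Cell r i) (Cell \<one> j)" using ij r by simp
    then have "meet (Cell (\<alpha> r) i) (Cell (\<alpha> \<one>) j)"
      using meet[of "Cell r i" "Cell \<one> j"] cell ij r by simp
    moreover have "\<alpha> r \<noteq> \<alpha> \<one>" "i \<noteq> j" using \<alpha>_inj r False ij by auto
    ultimately show ?thesis using ij r \<alpha>_closed by simp
  qed (use \<alpha>_closed in simp)
  have "\<phi> v = act (\<alpha> \<one>) v" if "v \<in> V" for v
  proof (cases v)
    case (Cell r i)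
    then show ?thesis using cell \<alpha>_eq[of r] that by simp
  next
    case (Row r)
    then show ?thesis using \<alpha> \<alpha>_eq[of r] that by simp
  next
    case (Path i)
    then show ?thesis using path that by simp
  qed
  then show ?thesis using \<alpha>_closed by blast
qed

section \<open>Assembly of the language\<close>

lemma exists_language:
  assumes "\<gamma> > 0" "\<theta> > 0"
  shows "\<exists>(n :: nat) (L :: bool list set).
    L \<subseteq> {w. length w = 24 * n} \<and> finite L \<and> card L = n \<and>
    Isom (lev \<gamma> \<theta>) L \<cong> G \<and>
    (\<forall>u\<in>L. \<forall>v\<in>L. u \<noteq> v \<longrightarrow>
      lev \<gamma> \<theta> u v \<in> {4 * letter_dist \<gamma> \<theta>, 6 * letter_dist \<gamma> \<theta>})"
proof -
  have "\<exists>f :: 'a vertex \<Rightarrow> bool list. inj_on f V \<and> (\<forall>v\<in>V. length (f v) = 24 * card V) \<and>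
    (\<forall>u\<in>V. \<forall>v\<in>V. u \<noteq> v \<longrightarrow>
      lev \<gamma> \<theta> (f u) (f v) = (if triple u \<inter> triple v = {} then 6 else 4) * letter_dist \<gamma> \<theta>)"
    using assms by (intro code_of_triples finite_V card_triple card_triple_Int)
  then obtain f :: "'a vertex \<Rightarrow> bool list" where f: "inj_on f V" "\<forall>v\<in>V. length (f v) = 24 * card V"
    and lev': "\<forall>u\<in>V. \<forall>v\<in>V. u \<noteq> v \<longrightarrow>
      lev \<gamma> \<theta> (f u) (f v) = (if triple u \<inter> triple v = {} then 6 else 4) * letter_dist \<gamma> \<theta>"
    by blast
  have lev: "lev \<gamma> \<theta> (f u) (f v) = (if triple u \<inter> triple v = {} then 6 else 4) * letter_dist \<gamma> \<theta>"
    if "u \<in> V" "v \<in> V" "u \<noteq> v" for u v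
    using lev' that by blast
  have c: "letter_dist \<gamma> \<theta> > 0" using assms by (simp add: letter_dist_def)
  \<comment> \<open>As the unit is positive, the distances 4 and 6 tell meeting triples from
    disjoint ones, so isometries of the code correspond to automorphisms of the graph.\<close>
  have meet_iff: "meet u v \<longleftrightarrow> u = v \<or> lev \<gamma> \<theta> (f u) (f v) = 4 * letter_dist \<gamma> \<theta>"
    if "u \<in> V" "v \<in> V" for u v
  proof (cases "u = v")
    case True
    then show ?thesis by (cases v) auto
  next
    case False
    then show ?thesis using lev[OF that] c by (simp add: meet_def)
  qed
  have "Isom (lev \<gamma> \<theta>) (f ` V) \<cong> G"
  proof (rule Isom_iso_by_action[where V = V and f = f and act = act])
    show "bij_betw f V (f ` V)" using f(1) by (simp add: bij_betw_def)
    show "lev \<gamma> \<theta> (f (act g u)) (f (act g v)) = lev \<gamma> \<theta> (f u) (f v)"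
      if "g \<in> carrier G" "u \<in> V" "v \<in> V" for g u v
    proof (cases "u = v")
      case False
      then show ?thesis
        using lev[of u v] lev[of "act g u" "act g v"] act_meet[OF that] act_eq_iff[OF that] that
        by (simp add: act_closed meet_def)
    qed (use assms in \<open>simp add: lev_refl\<close>)
    show "\<exists>g\<in>carrier G. \<forall>v\<in>V. \<phi> v = act g v" if bij: "bij_betw \<phi> V V"
      and iso: "\<And>u v. u \<in> V \<Longrightarrow> v \<in> V \<Longrightarrow> lev \<gamma> \<theta> (f (\<phi> u)) (f (\<phi> v)) = lev \<gamma> \<theta> (f u) (f v)"
      for \<phi>
    proof (rule automorphism_is_act[OF bij])
      fix u v assume uv: "u \<in> V" "v \<in> V"
      have "\<phi> u \<in> V" "\<phi> v \<in> V" "\<phi> u = \<phi> v \<longleftrightarrow> u = v"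
        using bij_betwE[OF bij] inj_on_eq_iff[OF bij_betw_imp_inj_on[OF bij]] uv by blast+
      then show "meet (\<phi> u) (\<phi> v) \<longleftrightarrow> meet u v" using meet_iff iso uv by simp
    qed
  qed (use is_group act_closed act_one act_mult act_faithful in auto)
  moreover have "card (f ` V) = card V" by (rule card_image[OF f(1)])
  moreover have "f ` V \<subseteq> {w. length w = 24 * card V}" using f(2) by auto
  moreover have "lev \<gamma> \<theta> u v \<in> {4 * letter_dist \<gamma> \<theta>, 6 * letter_dist \<gamma> \<theta>}"
    if uv: "u \<in> f ` V" "v \<in> f ` V" "u \<noteq> v" for u v
  proof -
    obtain x y where "x \<in> V" "y \<in> V" "u = f x" "v = f y" using uv by blast
    then show ?thesis using lev[of x y] uv(3) by (cases "x = y") simp_all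
  qed
  ultimately show ?thesis using finite_V
    by (intro exI[of _ "card V"] exI[of _ "f ` V"]) auto
qed

end

theorem theorem2:
  fixes G :: "('g, 'x) monoid_scheme" and \<gamma> \<theta> :: real
  assumes "group G" and "finite (carrier G)"
    and "\<gamma> > 0" and "\<theta> > 0"
  shows "\<exists>(n :: nat) (L :: bool list set).
    L \<subseteq> {w. length w = 24 * n} \<and> finite L \<and> card L = n \<and>
    Isom (lev \<gamma> \<theta>) L \<cong> G \<and>
    (\<forall>u\<in>L. \<forall>v\<in>L. u \<noteq> v \<longrightarrow>
      lev \<gamma> \<theta> u v \<in> {4 * letter_dist \<gamma> \<theta>, 6 * letter_dist \<gamma> \<theta>})"
proof (cases "card (carrier G) \<ge> 2")
  \<comment> \<open>The trivial group is outside the scope of the locale, where \<open>k\<close> is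
    at least 2. A single word of length 24 serves as the language, with the distance condition
    vacuous.\<close>
  case False
  interpret group G by (rule assms(1))
  have "carrier G \<noteq> {}" using one_closed by blast
  then have "card (carrier G) = 1" using assms(2) False card_0_eq[of "carrier G"] by linarith
  then have G: "carrier G = {\<one>\<^bsub>G\<^esub>}" using one_closed by (metis card_1_singletonE singletonD)
  let ?w = "replicate 24 False"
  have "Isom (lev \<gamma> \<theta>) {?w} \<cong> G"
    by (rule Isom_iso_by_action[where f = "\<lambda>_. ?w" and V = "{()}" and act = "\<lambda>_ _. ()"])
      (use assms(1) G in \<open>auto simp: bij_betw_def\<close>)
  then show ?thesis by (intro exI[of _ 1] exI[of _ "{?w}"]) auto
next
  case True
  obtain e where "bij_betw e {1..card (carrier G)} (carrier G)"
    using ex_bij_betw_nat_finite_1[OF assms(2)] by blast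
  then interpret cayley_table G "card (carrier G)" e
    using assms(1) True by (simp add: cayley_table_def cayley_table_axioms_def)
  show ?thesis by (rule exists_language[OF assms(3,4)])
qed

end
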